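(* Let $p>1$ and let $f:(0,\infty)\to[0,\infty)$ be a measurable function with $f\in L^p(0,\infty)$. For $t>0$ let $A(t)=\frac1t\int_0^t f(s)\,ds$ and let $M(t)$ be the lower median of $f$ on $(0,t)$. Then \[ \int_0^\infty |M(t)-A(t)|^p\,dt\leq 2^{1-p}\left(\frac{p}{p-1}\right)^p\int_0^\infty f(t)^p\,dt. \] Equivalently, \[ \|M-A\|_{L^p(0,\infty)}\leq 2^{1/p-1}\,\frac{p}{p-1}\,\|f\|_{L^p(0,\infty)}. \]
   Context: Here $p$ is a real number and $\operatorname{meas}$ denotes Lebesgue measure on $(0,\infty)$. For a nonnegative measurable function $f$ on $(0,\infty)$ and $t>0$, the lower median of $f$ on $(0,t)$ is \[ M(t)=\inf\left\{a\in\mathbb R:\operatorname{meas}\{s\in(0,t):f(s)\leq a\}\geq \tfrac t2\right\}. \] Then $M(t)\ge 0$, and the function $t\mapsto M(t)$ is measurable, so the integrals above are well defined. *)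

theory Defs
  imports "HOL-Analysis.Analysis"
begin

text \<open>
  Functions on the half-line \<open>(0, \<infinity>)\<close> are represented by functions on \<open>real\<close>
  whose values outside \<open>{0<..}\<close> are never inspected.
\<close>

abbreviation half_line :: "real measure"
  where "half_line \<equiv> lebesgue_on {0<..}"

definition Lp :: "real \<Rightarrow> (real \<Rightarrow> real) set"
  where "Lp p = {g. g \<in> borel_measurable half_line \<and>
                    integrable half_line (\<lambda>t. \<bar>g t\<bar> powr p)}"

definition Lp_norm :: "real \<Rightarrow> (real \<Rightarrow> real) \<Rightarrow> real"
  where "Lp_norm p g = (LINT t|half_line. \<bar>g t\<bar> powr p) powr (1 / p)"

definition average :: "(real \<Rightarrow> real) \<Rightarrow> real \<Rightarrow> real"
  where "average f t = (1 / t) * (LINT s:{0<..<t}|lebesgue. f s)"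

text \<open>
  For measurable \<open>f \<ge> 0\<close> and \<open>t > 0\<close> the set below is nonempty and bounded below by 0,
  so the infimum in the type \<open>real\<close> is the true one.
\<close>

definition lower_median :: "(real \<Rightarrow> real) \<Rightarrow> real \<Rightarrow> real"
  where "lower_median f t = Inf {a. measure lebesgue {s \<in> {0<..<t}. f s \<le> a} \<ge> t / 2}"

end

theory Submission
  imports Defs
begin

text \<open>
  Fix \<open>t > 0\<close>, and let \<open>m\<close> be the lower median and \<open>A\<close> the average of \<open>f\<close> on \<open>(0, t)\<close>. Each of the sets
  \<open>{f > m}\<close> and \<open>{f < m}\<close> fills at most half of \<open>(0, t)\<close>, and at \<open>m \<ge> 0\<close> the positive and the negative
  part of \<open>f - m\<close> pull the average in opposite directions. Keeping only the part that helps,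
  \<open>t (A - m)\<close> is at most the integral of \<open>f\<close> over \<open>{f > m}\<close>, and \<open>t (m - A)\<close> is at most \<open>m t / 2\<close>.
  In terms of the decreasing rearrangement \<open>f*\<close> of \<open>f\<close> both numbers are bounded by the integral of \<open>f*\<close>
  over \<open>(0, t / 2)\<close>: the first because no set of measure \<open>t / 2\<close> carries a larger integral of \<open>f\<close>, the
  second because \<open>f \<ge> m\<close> on a set of measure at least \<open>t / 2\<close>, so that \<open>f* \<ge> m\<close> on \<open>(0, t / 2)\<close>.
  This is \<open>median_minus_average_le_rearrangement\<close>.

  Hence \<open>\<bar>m - A\<bar>\<close> is at most half the average of \<open>f*\<close> over \<open>(0, t / 2)\<close>. By \<open>hardy_inequality\<close> the running
  average of \<open>f*\<close> costs a factor \<open>(p / (p - 1)) powr p\<close> in the integral of the \<open>p\<close>-th power; the factor \<open>1 / 2\<close>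
  contributes \<open>2 powr - p\<close> and the dilation \<open>t \<mapsto> t / 2\<close> contributes \<open>2\<close>, which gives
  \<open>2 powr (1 - p)\<close>. Finally \<open>f\<close> and \<open>f*\<close> have level sets of equal measure, so their \<open>p\<close>-th powers have the same
  integral (\<open>nn_integral_rearr_powr\<close>).
\<close>

section \<open>The layer cake formula and the decreasing rearrangement\<close>

lemma sigma_finite_lebesgue: "sigma_finite_measure (lebesgue :: 'a::euclidean_space measure)"
proof -
  obtain A :: "'a set set" where A: "countable A" "A \<subseteq> sets lborel" "\<Union>A = space lborel"
      "\<forall>a\<in>A. emeasure lborel a \<noteq> \<infinity>"
    using lborel.sigma_finite_countable by blast
  have "emeasure lebesgue a = emeasure lborel a" if "a \<in> A" for a
    using A(2) that by (simp add: subset_iff)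
  then show ?thesis
    using A by (intro sigma_finite_measure.intro exI[of _ A]) (simp add: subset_iff)
qed

text \<open>
  Each value \<open>f x\<close> is the length of \<open>{0..<f x}\<close>; exchanging the order of integration over the region
  below the graph turns the sum over points into a sum over levels. Integrals of functions on different
  measure spaces become comparable this way, through the measures of their level sets.
\<close>

lemma nn_integral_layer_cake:
  fixes f :: "'a \<Rightarrow> real"
  assumes "sigma_finite_measure M" and [measurable]: "f \<in> borel_measurable M"
    and nonneg: "\<And>x. x \<in> space M \<Longrightarrow> 0 \<le> f x"
  shows "(\<integral>\<^sup>+x. ennreal (f x) \<partial>M) = (\<integral>\<^sup>+l\<in>{0..}. emeasure M {x \<in> space M. l < f x} \<partial>lborel)"
proof -
  interpret sigma_finite_measure M by fact
  interpret pair_sigma_finite M lborel ..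
  have "(\<integral>\<^sup>+x. ennreal (f x) \<partial>M) = (\<integral>\<^sup>+x. (\<integral>\<^sup>+l. indicator {z. 0 \<le> snd z \<and> snd z < f (fst z)} (x, l) \<partial>lborel) \<partial>M)"
  proof (rule nn_integral_cong)
    fix x assume "x \<in> space M"
    then have "ennreal (f x) = emeasure lborel {0..<f x}" using nonneg by simp
    also have "\<dots> = (\<integral>\<^sup>+l. indicator {0..<f x} l \<partial>lborel)" by simp
    finally show "ennreal (f x) = (\<integral>\<^sup>+l. indicator {z. 0 \<le> snd z \<and> snd z < f (fst z)} (x, l) \<partial>lborel)"
      by (simp add: indicator_def)
  qed
  also have "\<dots> = (\<integral>\<^sup>+l. (\<integral>\<^sup>+x. indicator {z. 0 \<le> snd z \<and> snd z < f (fst z)} (x, l) \<partial>M) \<partial>lborel)"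
    by (rule Fubini'[symmetric]) (simp add: indicator_def, measurable)
  also have "\<dots> = (\<integral>\<^sup>+l\<in>{0..}. emeasure M {x \<in> space M. l < f x} \<partial>lborel)"
  proof (rule nn_integral_cong)
    fix l :: real
    have "(\<integral>\<^sup>+x. indicator {z. 0 \<le> snd z \<and> snd z < f (fst z)} (x, l) \<partial>M)
        = (\<integral>\<^sup>+x. indicator {0..} l * indicator {x \<in> space M. l < f x} x \<partial>M)"
      by (intro nn_integral_cong) (auto simp: indicator_def)
    also have "\<dots> = emeasure M {x \<in> space M. l < f x} * indicator {0..} l"
      by (subst nn_integral_cmult) (auto simp: mult.commute)
    finally show "(\<integral>\<^sup>+x. indicator {z. 0 \<le> snd z \<and> snd z < f (fst z)} (x, l) \<partial>M)
        = emeasure M {x \<in> space M. l < f x} * indicator {0..} l" .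
  qed
  finally show ?thesis .
qed

text \<open>
  The value \<open>0\<close> for \<open>s \<le> 0\<close> keeps the function nonnegative and Borel measurable on the whole line.
\<close>

definition decreasing_rearrangement :: "'a measure \<Rightarrow> ('a \<Rightarrow> real) \<Rightarrow> real \<Rightarrow> real"
  where "decreasing_rearrangement M f s =
    (if 0 < s then Inf {l. 0 \<le> l \<and> emeasure M {x \<in> space M. l < f x} \<le> ennreal s} else 0)"

text \<open>
  The rearrangement is a generalized inverse of the distribution function \<open>l \<mapsto> \<mu> {l < f}\<close>. That strict
  inequalities correspond to strict inequalities rests on the right continuity of the distribution function.
\<close>

lemma less_decreasing_rearrangement_iff:
  assumes [measurable]: "f \<in> borel_measurable M"
    and ex: "\<exists>l\<ge>0. emeasure M {x \<in> space M. l < f x} \<le> ennreal s"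
    and "0 < s" "0 \<le> l"
  shows "l < decreasing_rearrangement M f s \<longleftrightarrow> ennreal s < emeasure M {x \<in> space M. l < f x}"
proof
  let ?\<mu> = "\<lambda>l. emeasure M {x \<in> space M. l < f x}"
  let ?S = "{l. 0 \<le> l \<and> ?\<mu> l \<le> ennreal s}"
  have eq: "decreasing_rearrangement M f s = Inf ?S"
    using \<open>0 < s\<close> by (simp add: decreasing_rearrangement_def)
  have bdd: "bdd_below ?S" by (rule bdd_belowI[of _ 0]) auto
  show "ennreal s < ?\<mu> l" if "l < decreasing_rearrangement M f s"
  proof (rule ccontr)
    assume "\<not> ennreal s < ?\<mu> l"
    then have "Inf ?S \<le> l" using \<open>0 \<le> l\<close> bdd by (intro cInf_lower) auto
    with that eq show False by simp
  qed
  assume less: "ennreal s < ?\<mu> l"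
  \<comment> \<open>The strict inequality survives at some level above \<open>l\<close>, which separates \<open>l\<close> from the infimum.\<close>
  have "(\<lambda>n. ?\<mu> (l + 1 / real (Suc n))) \<longlonglongrightarrow> emeasure M (\<Union>n. {x \<in> space M. l + 1 / real (Suc n) < f x})"
  proof (rule Lim_emeasure_incseq)
    show "incseq (\<lambda>n. {x \<in> space M. l + 1 / real (Suc n) < f x})"
    proof (rule incseq_SucI)
      fix n have "1 / real (Suc (Suc n)) \<le> 1 / real (Suc n)" by (simp add: frac_le)
      then show "{x \<in> space M. l + 1 / real (Suc n) < f x} \<subseteq> {x \<in> space M. l + 1 / real (Suc (Suc n)) < f x}"
        by auto
    qed
  qed auto
  also have "(\<Union>n. {x \<in> space M. l + 1 / real (Suc n) < f x}) = {x \<in> space M. l < f x}"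
  proof (intro equalityI subsetI)
    fix x assume x: "x \<in> {x \<in> space M. l < f x}"
    then obtain n where "1 / real (Suc n) < f x - l"
      by (metis (no_types, lifting) diff_gt_0_iff_gt mem_Collect_eq nat_approx_posE)
    with x show "x \<in> (\<Union>n. {x \<in> space M. l + 1 / real (Suc n) < f x})" by auto (metis add.commute less_diff_eq)
  next
    fix x assume "x \<in> (\<Union>n. {x \<in> space M. l + 1 / real (Suc n) < f x})"
    then obtain n where "x \<in> space M" "l + 1 / real (Suc n) < f x" by auto
    moreover have "0 < 1 / real (Suc n)" by simp
    ultimately show "x \<in> {x \<in> space M. l < f x}" by (smt (verit) mem_Collect_eq)
  qed
  finally have "eventually (\<lambda>n. ennreal s < ?\<mu> (l + 1 / real (Suc n))) sequentially"
    using less by (rule order_tendstoD)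
  then obtain n where n: "ennreal s < ?\<mu> (l + 1 / real (Suc n))"
    by (auto simp: eventually_sequentially)
  have "l < l + 1 / real (Suc n)" by simp
  also have "\<dots> \<le> Inf ?S"
  proof (rule cInf_greatest)
    show "?S \<noteq> {}" using ex by auto
    fix k assume k: "k \<in> ?S"
    show "l + 1 / real (Suc n) \<le> k"
    proof (rule ccontr)
      assume "\<not> l + 1 / real (Suc n) \<le> k"
      then have "?\<mu> (l + 1 / real (Suc n)) \<le> ?\<mu> k" by (intro emeasure_mono) auto
      with n k show False by auto
    qed
  qed
  finally show "l < decreasing_rearrangement M f s" using eq by simp
qed

text \<open>
  In the extended sense, including \<open>m = \<infinity>\<close>: the initial segment of length \<open>m\<close>.
\<close>

lemma emeasure_lborel_initial_segment:
  "emeasure lborel {s::real. 0 < s \<and> ennreal s < m} = m"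
proof (cases m)
  case (real r)
  then have "{s::real. 0 < s \<and> ennreal s < m} = {0<..<r}"
    by (auto simp: ennreal_less_iff)
  with real show ?thesis by simp
next
  case top
  then have "{s::real. 0 < s \<and> ennreal s < m} = {0<..}" by auto
  moreover have "emeasure lborel {0::real<..} = \<infinity>"
  proof -
    have "ennreal (real n) \<le> emeasure lborel {0::real<..}" for n
    proof -
      have "ennreal (real n) = emeasure lborel {0<..<real n}" by simp
      also have "\<dots> \<le> emeasure lborel {0::real<..}" by (intro emeasure_mono) auto
      finally show ?thesis .
    qed
    then have "\<not> emeasure lborel {0::real<..} < top"
      using ennreal_Ex_less_of_nat[of "emeasure lborel {0::real<..}"]
      by (metis ennreal_of_nat_eq_real_of_nat leD)
    then show ?thesis by (metis infinity_ennreal_def less_top)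
  qed
  ultimately show ?thesis using top by simp
qed

text \<open>
  Smallness of the level sets at high levels makes the rearrangement finite at every \<open>s > 0\<close>: otherwise the
  set defining it could be empty, with a meaningless infimum. Membership in a Lebesgue space provides it.
\<close>

locale rearrangeable = sigma_finite_measure M for M :: "'a measure" +
  fixes f :: "'a \<Rightarrow> real"
  assumes f_measurable [measurable]: "f \<in> borel_measurable M"
    and f_nonneg: "x \<in> space M \<Longrightarrow> 0 \<le> f x"
    and level_small: "0 < s \<Longrightarrow> \<exists>l\<ge>0. emeasure M {x \<in> space M. l < f x} \<le> ennreal s"
begin

abbreviation rearr :: "real \<Rightarrow> real" where "rearr \<equiv> decreasing_rearrangement M f"

lemma less_rearr_iff:
  "0 < s \<Longrightarrow> 0 \<le> l \<Longrightarrow> l < rearr s \<longleftrightarrow> ennreal s < emeasure M {x \<in> space M. l < f x}"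
  by (intro less_decreasing_rearrangement_iff level_small f_measurable)

lemma rearr_nonneg: "0 \<le> rearr s"
proof (cases "0 < s")
  case True
  then show ?thesis using level_small[OF True]
    unfolding decreasing_rearrangement_def by (auto intro!: cInf_greatest)
qed (simp add: decreasing_rearrangement_def)

lemma rearr_measurable [measurable]: "rearr \<in> borel_measurable borel"
proof (rule borel_measurableI_greater)
  fix l :: real
  show "{s \<in> space borel. l < rearr s} \<in> sets borel"
  proof (cases "0 \<le> l")
    case True
    then have "{s \<in> space borel. l < rearr s}
        = {s \<in> space borel. 0 < s \<and> ennreal s < emeasure M {x \<in> space M. l < f x}}"
      using less_rearr_iff by (auto simp: decreasing_rearrangement_def)
    also have "\<dots> \<in> sets borel" by measurable
    finally show ?thesis .
  next
    case False
    then have "l < rearr s" for s using rearr_nonneg[of s] by linarith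
    then have "{s \<in> space borel. l < rearr s} = UNIV" by simp
    then show ?thesis by simp
  qed
qed

text \<open>
  The rearrangement has level sets of the same measure as \<open>f\<close>, and they are initial segments, so cutting them
  at \<open>m\<close> leaves the smaller of the two lengths. The case \<open>m = \<infinity>\<close> is equimeasurability.
\<close>

lemma emeasure_rearr_level:
  assumes "0 \<le> l"
  shows "emeasure lborel {s. 0 < s \<and> ennreal s < m \<and> l < rearr s}
    = min m (emeasure M {x \<in> space M. l < f x})"
proof -
  have "{s. 0 < s \<and> ennreal s < m \<and> l < rearr s}
      = {s. 0 < s \<and> ennreal s < min m (emeasure M {x \<in> space M. l < f x})}"
    using less_rearr_iff[OF _ assms] by auto
  then show ?thesis by (simp only: emeasure_lborel_initial_segment)
qed

lemma nn_integral_rearr_powr: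
  assumes "0 < p"
  shows "(\<integral>\<^sup>+s\<in>{0<..}. ennreal (rearr s powr p) \<partial>lborel) = (\<integral>\<^sup>+x. ennreal (f x powr p) \<partial>M)"
proof -
  have root: "l < y powr p \<longleftrightarrow> l powr (1 / p) < y" if "0 \<le> l" "0 \<le> y" for l y :: real
  proof -
    have "(l powr (1 / p)) powr p = l" using assms that by (simp add: powr_powr)
    then show ?thesis
      by (metis assms powr_less_cancel2 powr_less_mono2 powr_ge_zero that(2) linorder_not_less powr_mono2 less_imp_le)
  qed
  have "(\<integral>\<^sup>+s\<in>{0<..}. ennreal (rearr s powr p) \<partial>lborel)
      = (\<integral>\<^sup>+s. ennreal (rearr s powr p * indicator {0<..} s) \<partial>lborel)"
    by (intro nn_integral_cong) (auto split: split_indicator)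
  also have "\<dots> = (\<integral>\<^sup>+l\<in>{0..}. emeasure lborel {s \<in> space lborel. l < rearr s powr p * indicator {0<..} s} \<partial>lborel)"
    by (intro nn_integral_layer_cake sigma_finite_lborel) auto
  also have "\<dots> = (\<integral>\<^sup>+l\<in>{0..}. emeasure M {x \<in> space M. l < f x powr p} \<partial>lborel)"
  proof (rule nn_integral_cong)
    fix l :: real
    have "emeasure lborel {s \<in> space lborel. l < rearr s powr p * indicator {0<..} s}
        = emeasure M {x \<in> space M. l < f x powr p}" if l: "0 \<le> l"
    proof -
      have "{s \<in> space lborel. l < rearr s powr p * indicator {0<..} s}
          = {s. 0 < s \<and> ennreal s < \<infinity> \<and> l powr (1 / p) < rearr s}"
        using l root[OF l rearr_nonneg] by (auto simp: indicator_def split: if_splits)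
      moreover have "{x \<in> space M. l < f x powr p} = {x \<in> space M. l powr (1 / p) < f x}"
        using root[OF l f_nonneg] by auto
      ultimately show ?thesis
        using emeasure_rearr_level[of "l powr (1 / p)" \<infinity>] by (simp add: min_absorb2)
    qed
    then show "emeasure lborel {s \<in> space lborel. l < rearr s powr p * indicator {0<..} s} * indicator {0..} l
        = emeasure M {x \<in> space M. l < f x powr p} * indicator {0..} l"
      by (cases "0 \<le> l") simp_all
  qed
  also have "\<dots> = (\<integral>\<^sup>+x. ennreal (f x powr p) \<partial>M)"
    by (intro nn_integral_layer_cake[symmetric] sigma_finite_measure_axioms) auto
  finally show ?thesis .
qed

text \<open>
  The rearrangement moves the largest values of \<open>f\<close> to the front. At each level \<open>l\<close> the part of \<open>E\<close> where
  \<open>f\<close> exceeds \<open>l\<close> measures at most the smaller of \<open>t\<close> and the measure of \<open>{l < f}\<close>, and for the rearrangement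
  \<open>(0, t)\<close> attains this bound.
\<close>

lemma set_nn_integral_le_rearr:
  assumes [measurable]: "E \<in> sets M" and E: "emeasure M E \<le> ennreal t"
  shows "(\<integral>\<^sup>+x\<in>E. ennreal (f x) \<partial>M) \<le> (\<integral>\<^sup>+s\<in>{0<..<t}. ennreal (rearr s) \<partial>lborel)"
proof -
  have "(\<integral>\<^sup>+x\<in>E. ennreal (f x) \<partial>M) = (\<integral>\<^sup>+x. ennreal (f x * indicator E x) \<partial>M)"
    by (intro nn_integral_cong) (auto split: split_indicator)
  also have "\<dots> = (\<integral>\<^sup>+l\<in>{0..}. emeasure M {x \<in> space M. l < f x * indicator E x} \<partial>lborel)"
    by (intro nn_integral_layer_cake sigma_finite_measure_axioms) (auto simp: f_nonneg)
  also have "\<dots> \<le> (\<integral>\<^sup>+l\<in>{0..}. emeasure lborel {s \<in> space lborel. l < rearr s * indicator {0<..<t} s} \<partial>lborel)"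
  proof (rule nn_integral_mono)
    fix l :: real
    have "emeasure M {x \<in> space M. l < f x * indicator E x}
        \<le> emeasure lborel {s \<in> space lborel. l < rearr s * indicator {0<..<t} s}" if l: "0 \<le> l"
    proof -
      have "emeasure M {x \<in> space M. l < f x * indicator E x} \<le> emeasure M E"
        using l by (intro emeasure_mono) (auto split: split_indicator_asm)
      moreover have "emeasure M {x \<in> space M. l < f x * indicator E x}
          \<le> emeasure M {x \<in> space M. l < f x}"
        using l by (intro emeasure_mono) (auto split: split_indicator_asm)
      ultimately have "emeasure M {x \<in> space M. l < f x * indicator E x}
          \<le> min (ennreal t) (emeasure M {x \<in> space M. l < f x})" using E by auto
      also have "\<dots> = emeasure lborel {s. 0 < s \<and> ennreal s < ennreal t \<and> l < rearr s}"
        using emeasure_rearr_level[OF l] by simp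
      also have "{s. 0 < s \<and> ennreal s < ennreal t \<and> l < rearr s}
          = {s \<in> space lborel. l < rearr s * indicator {0<..<t} s}"
        using l by (auto simp: ennreal_less_iff split: split_indicator split_indicator_asm)
      finally show ?thesis .
    qed
    then show "emeasure M {x \<in> space M. l < f x * indicator E x} * indicator {0..} l
        \<le> emeasure lborel {s \<in> space lborel. l < rearr s * indicator {0<..<t} s} * indicator {0..} l"
      by (cases "0 \<le> l") simp_all
  qed
  also have "\<dots> = (\<integral>\<^sup>+s. ennreal (rearr s * indicator {0<..<t} s) \<partial>lborel)"
    by (intro nn_integral_layer_cake[symmetric] sigma_finite_lborel) (auto simp: rearr_nonneg)
  also have "\<dots> = (\<integral>\<^sup>+s\<in>{0<..<t}. ennreal (rearr s) \<partial>lborel)"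
    by (intro nn_integral_cong) (auto split: split_indicator)
  finally show ?thesis .
qed

end

section \<open>Hardy's inequality\<close>

text \<open>
  Young's inequality for \<open>y = x * s powr (1 / p)\<close> and \<open>m powr (p - 1)\<close>: the graph of \<open>y \<mapsto> y powr p\<close> lies above its
  tangent at \<open>m\<close>. The extra factor \<open>s powr (- 1 / p)\<close> is the weight with which Hardy's inequality averages.
\<close>

lemma weighted_tangent_bound:
  fixes p m x s :: real
  assumes "1 < p" "0 \<le> m" "0 \<le> x" "0 < s"
  shows "p * m powr (p - 1) * x \<le> x powr p * s powr (1 - 1 / p) + (p - 1) * m powr p * s powr (- 1 / p)"
proof -
  define q where "q = p / (p - 1)"
  define y where "y = x * s powr (1 / p)"
  have q: "1 < q" "1 / p + 1 / q = 1" using assms by (auto simp: q_def field_simps)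
  have "y * m powr (p - 1) \<le> y powr p / p + (m powr (p - 1)) powr q / q"
    using assms q by (intro Youngs_inequality) (auto simp: y_def)
  also have "(m powr (p - 1)) powr q = m powr p"
    using assms by (simp add: powr_powr q_def)
  finally have "p * (y * m powr (p - 1)) \<le> p * (y powr p / p + m powr p / q)"
    using assms by (intro mult_left_mono) auto
  also have "\<dots> = y powr p + (p - 1) * m powr p"
    using assms by (simp add: q_def field_simps)
  finally have "p * (y * m powr (p - 1)) * s powr (- 1 / p) \<le> (y powr p + (p - 1) * m powr p) * s powr (- 1 / p)"
    by (intro mult_right_mono) auto
  moreover have "s powr (1 / p) * s powr (- 1 / p) = 1"
    using assms by (simp flip: powr_add)
  moreover have "y powr p * s powr (- 1 / p) = x powr p * s powr (1 - 1 / p)"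
  proof -
    have "y powr p = x powr p * s powr 1" using assms by (simp add: y_def powr_mult powr_powr)
    moreover have "s powr 1 * s powr (- 1 / p) = s powr (1 - 1 / p)"
      by (simp only: powr_add[symmetric]) simp
    ultimately show ?thesis by (metis mult.assoc)
  qed
  ultimately show ?thesis by (simp add: y_def algebra_simps)
qed

lemma nn_integral_powr_from_0:
  assumes "1 < (p::real)" "0 < t"
  shows "(\<integral>\<^sup>+s\<in>{0<..<t}. ennreal (s powr (- 1 / p)) \<partial>lborel)
    = ennreal (p / (p - 1) * t powr (1 - 1 / p))"
proof -
  have "((\<lambda>s. s powr (- 1 / p)) has_integral (t powr (- 1 / p + 1) / (- 1 / p + 1))) {0..t}"
    using assms by (intro has_integral_powr_from_0) (auto simp: field_simps)
  then have "(\<integral>\<^sup>+s\<in>{0..t}. ennreal (s powr (- 1 / p)) \<partial>lborel)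
    = ennreal (t powr (- 1 / p + 1) / (- 1 / p + 1))"
    by (intro nn_integral_has_integral_lebesgue') auto
  moreover have "(\<integral>\<^sup>+s\<in>{0<..<t}. ennreal (s powr (- 1 / p)) \<partial>lborel)
      = (\<integral>\<^sup>+s\<in>{0..t}. ennreal (s powr (- 1 / p)) \<partial>lborel)"
    using AE_lborel_singleton[of 0] AE_lborel_singleton[of t]
    by (intro nn_integral_cong_AE) (auto split: split_indicator)
  moreover have "- 1 / p + 1 = (p - 1) / p" "1 - 1 / p = (p - 1) / p" using assms by (auto simp: field_simps)
  ultimately show ?thesis by (simp add: mult.commute)
qed

lemma nn_integral_powr_to_infinity:
  assumes "1 < (p::real)" "0 < s"
  shows "(\<integral>\<^sup>+t\<in>{s<..}. ennreal (t powr (1 / p - 2)) \<partial>lborel)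
    = ennreal (p / (p - 1) * s powr (1 / p - 1))"
proof -
  have e: "1 / p - 2 < - 1" using assms by (simp add: field_simps)
  have "((\<lambda>t. t powr (1 / p - 2)) has_integral - (s powr (1 / p - 2 + 1) / (1 / p - 2 + 1))) {s..}"
    using has_integral_powr_to_inf[OF e assms(2)] by simp
  then have "(\<integral>\<^sup>+t\<in>{s..}. ennreal (t powr (1 / p - 2)) \<partial>lborel)
    = ennreal (- (s powr (1 / p - 2 + 1) / (1 / p - 2 + 1)))"
    by (intro nn_integral_has_integral_lebesgue') auto
  moreover have "(\<integral>\<^sup>+t\<in>{s<..}. ennreal (t powr (1 / p - 2)) \<partial>lborel)
      = (\<integral>\<^sup>+t\<in>{s..}. ennreal (t powr (1 / p - 2)) \<partial>lborel)"
    using AE_lborel_singleton[of s]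
    by (intro nn_integral_cong_AE) (auto split: split_indicator)
  moreover have "- (s powr (1 / p - 2 + 1) / (1 / p - 2 + 1)) = p / (p - 1) * s powr (1 / p - 1)"
    using assms by (simp add: field_simps)
  ultimately show ?thesis by simp
qed

text \<open>
  Jensen's inequality for the average of \<open>g s * s powr (1 / p)\<close> over \<open>(0, t)\<close> with weight \<open>s powr (- 1 / p)\<close>. This
  weight is the one for which the sharp constant comes out: integrating the right-hand side over \<open>t > s\<close>
  produces a multiple of \<open>s powr (1 / p - 1)\<close>, which cancels the factor \<open>s powr (1 - 1 / p)\<close>.
\<close>

lemma hardy_pointwise:
  fixes g :: "real \<Rightarrow> real"
  assumes "1 < p" "0 < t" "0 \<le> a" and [measurable]: "g \<in> borel_measurable borel"
    and nonneg: "\<And>s. 0 < s \<Longrightarrow> 0 \<le> g s"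
    and a: "ennreal (t * a) \<le> (\<integral>\<^sup>+s\<in>{0<..<t}. ennreal (g s) \<partial>lborel)"
  shows "ennreal (a powr p) \<le> ennreal ((p / (p - 1)) powr (p - 1) * t powr (1 / p - 2))
    * (\<integral>\<^sup>+s\<in>{0<..<t}. ennreal (g s powr p * s powr (1 - 1 / p)) \<partial>lborel)"
    (is "_ \<le> _ * ?J")
proof -
  define q where "q = p / (p - 1)"
  \<comment> \<open>\<open>N\<close> is the total weight of \<open>(0, t)\<close>, and \<open>m\<close> is the weighted average that \<open>a\<close> stands for: \<open>m * N = t * a\<close>.\<close>
  define N where "N = q * t powr (1 - 1 / p)"
  define m where "m = a * t / N"
  have q: "0 < q" using assms by (simp add: q_def)
  have N: "0 < N" using q assms by (simp add: N_def)
  have m: "0 \<le> m" using N assms by (simp add: m_def)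
  have mm: "m powr (p - 1) * m = m powr p"
    using m assms by (cases "m = 0") (simp_all add: powr_diff)
  have "ennreal (p * (m powr p * N)) = ennreal (p * m powr (p - 1)) * ennreal (t * a)"
  proof -
    have "t * a = m * N" using N by (simp add: m_def)
    then have "p * (m powr p * N) = (p * m powr (p - 1)) * (t * a)"
      by (simp add: mm[symmetric] mult_ac)
    then show ?thesis using assms by (simp add: ennreal_mult mult.assoc)
  qed
  also have "\<dots> \<le> ennreal (p * m powr (p - 1)) * (\<integral>\<^sup>+s\<in>{0<..<t}. ennreal (g s) \<partial>lborel)"
    by (intro mult_left_mono a) auto
  also have "\<dots> = (\<integral>\<^sup>+s\<in>{0<..<t}. ennreal (p * m powr (p - 1) * g s) \<partial>lborel)"
    using assms by (subst nn_integral_cmult[symmetric])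
      (auto intro!: nn_integral_cong split: split_indicator simp: ennreal_mult')
  also have "\<dots> \<le> (\<integral>\<^sup>+s. ennreal (g s powr p * s powr (1 - 1 / p)) * indicator {0<..<t} s
      + ennreal ((p - 1) * m powr p) * (ennreal (s powr (- 1 / p)) * indicator {0<..<t} s) \<partial>lborel)"
    using assms m weighted_tangent_bound[OF assms(1) m nonneg]
    by (intro nn_integral_mono) (auto split: split_indicator simp: ennreal_leI simp flip: ennreal_mult ennreal_plus)
  also have "\<dots> = ?J + ennreal ((p - 1) * m powr p) * (\<integral>\<^sup>+s\<in>{0<..<t}. ennreal (s powr (- 1 / p)) \<partial>lborel)"
    by (subst nn_integral_add) (auto simp: nn_integral_cmult)
  also have "\<dots> = ?J + ennreal ((p - 1) * (m powr p * N))"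
    using assms N unfolding nn_integral_powr_from_0[OF assms(1,2)]
    by (simp add: N_def q_def mult.assoc flip: ennreal_mult)
  finally have le: "ennreal (p * (m powr p * N)) \<le> ?J + ennreal ((p - 1) * (m powr p * N))" .
  \<comment> \<open>The subtracted term is finite even if \<open>?J\<close> is not.\<close>
  then have J: "ennreal (m powr p * N) \<le> ?J"
  proof (cases ?J)
    case (real r)
    define X where "X = m powr p * N"
    have "0 \<le> X" using N by (simp add: X_def)
    then have "ennreal (p * X) \<le> ennreal (r + (p - 1) * X)"
      using le real assms(1) by (simp add: X_def)
    then have "p * X \<le> r + (p - 1) * X"
      using \<open>0 \<le> X\<close> real assms(1) by (subst (asm) ennreal_le_iff) auto
    then have "X \<le> r" by (simp add: algebra_simps)
    then show ?thesis using real by (simp add: X_def ennreal_leI)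
  qed simp
  have "a powr p = (q powr (p - 1) * t powr (1 / p - 2)) * (m powr p * N)"
  proof -
    have "t powr 1 * t powr (- 1 / p) = t powr (1 - 1 / p)"
      by (simp only: powr_add[symmetric]) simp
    then have N_eq: "N = t * (q * t powr (- 1 / p))" using assms by (simp add: N_def)
    have "a = m * N / t" using N assms by (simp add: m_def)
    then have "a = m * (q * t powr (- 1 / p))" using assms by (simp add: N_eq)
    then have "a powr p = m powr p * (q powr p * t powr (- 1))"
      using assms m q by (simp add: powr_mult powr_powr)
    moreover have "q powr p = q powr (p - 1) * q" using q by (simp add: powr_diff)
    moreover have "t powr (- 1) = t powr (1 / p - 2) * t powr (1 - 1 / p)" by (simp flip: powr_add)
    ultimately show ?thesis unfolding N_def by (simp only: mult_ac)
  qed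
  then have "ennreal (a powr p) = ennreal (q powr (p - 1) * t powr (1 / p - 2)) * ennreal (m powr p * N)"
    using N by (simp flip: ennreal_mult)
  also have "\<dots> \<le> ennreal (q powr (p - 1) * t powr (1 / p - 2)) * ?J"
    by (intro mult_left_mono J) auto
  finally show ?thesis unfolding q_def .
qed

text \<open>
  Stated for a real function \<open>h\<close> below the running average of \<open>g\<close>, since that average may be infinite and its
  powers would not make sense as real powers.
\<close>

lemma hardy_inequality:
  fixes g h :: "real \<Rightarrow> real"
  assumes "1 < p" and [measurable]: "g \<in> borel_measurable borel"
    and g: "\<And>s. 0 < s \<Longrightarrow> 0 \<le> g s"
    and h: "\<And>t. 0 < t \<Longrightarrow> 0 \<le> h t"
    and hg: "\<And>t. 0 < t \<Longrightarrow> ennreal (t * h t) \<le> (\<integral>\<^sup>+s\<in>{0<..<t}. ennreal (g s) \<partial>lborel)"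
  shows "(\<integral>\<^sup>+t\<in>{0<..}. ennreal (h t powr p) \<partial>lborel)
    \<le> ennreal ((p / (p - 1)) powr p) * (\<integral>\<^sup>+s\<in>{0<..}. ennreal (g s powr p) \<partial>lborel)"
proof -
  define q where "q = p / (p - 1)"
  have q: "0 < q" using assms by (simp add: q_def)
  \<comment> \<open>The double integral of \<open>k\<close> over \<open>0 < s < t\<close> is the integrated pointwise bound; it is evaluated in the other order.\<close>
  define k where "k s t = ennreal (t powr (1 / p - 2)) * (ennreal (g s powr p * s powr (1 - 1 / p))
    * indicator {z. 0 < fst z \<and> fst z < snd z} (s, t))" for s t :: real
  have [measurable]: "case_prod k \<in> borel_measurable (lborel \<Otimes>\<^sub>M lborel)"
    unfolding k_def by measurable
  have "(\<integral>\<^sup>+t\<in>{0<..}. ennreal (h t powr p) \<partial>lborel)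
      \<le> (\<integral>\<^sup>+t. ennreal (q powr (p - 1)) * (\<integral>\<^sup>+s. k s t \<partial>lborel) \<partial>lborel)"
  proof (rule nn_integral_mono)
    fix t :: real
    show "ennreal (h t powr p) * indicator {0<..} t \<le> ennreal (q powr (p - 1)) * (\<integral>\<^sup>+s. k s t \<partial>lborel)"
    proof (cases "0 < t")
      case True
      have "(\<integral>\<^sup>+s. k s t \<partial>lborel) = ennreal (t powr (1 / p - 2))
          * (\<integral>\<^sup>+s\<in>{0<..<t}. ennreal (g s powr p * s powr (1 - 1 / p)) \<partial>lborel)"
        unfolding k_def using True
        by (subst nn_integral_cmult[symmetric], measurable) (auto intro!: nn_integral_cong split: split_indicator)
      then show ?thesis
        using hardy_pointwise[OF assms(1) True h[OF True] assms(2) g hg[OF True]] True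
        by (simp add: q_def ennreal_mult mult.assoc)
    qed simp
  qed
  also have "\<dots> = ennreal (q powr (p - 1)) * (\<integral>\<^sup>+t. (\<integral>\<^sup>+s. k s t \<partial>lborel) \<partial>lborel)"
    by (intro nn_integral_cmult) measurable
  also have "(\<integral>\<^sup>+t. (\<integral>\<^sup>+s. k s t \<partial>lborel) \<partial>lborel) = (\<integral>\<^sup>+s. (\<integral>\<^sup>+t. k s t \<partial>lborel) \<partial>lborel)"
    by (rule lborel_pair.Fubini') measurable
  also have "\<dots> = (\<integral>\<^sup>+s. ennreal q * (ennreal (g s powr p) * indicator {0<..} s) \<partial>lborel)"
  proof (rule nn_integral_cong)
    fix s :: real
    show "(\<integral>\<^sup>+t. k s t \<partial>lborel) = ennreal q * (ennreal (g s powr p) * indicator {0<..} s)"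
    proof (cases "0 < s")
      case True
      have "(\<integral>\<^sup>+t. k s t \<partial>lborel) = (\<integral>\<^sup>+t. ennreal (g s powr p * s powr (1 - 1 / p))
          * (ennreal (t powr (1 / p - 2)) * indicator {s<..} t) \<partial>lborel)"
        using True by (intro nn_integral_cong) (auto simp: k_def mult_ac split: split_indicator)
      also have "\<dots> = ennreal (g s powr p * s powr (1 - 1 / p)) * ennreal (q * s powr (1 / p - 1))"
        unfolding q_def using nn_integral_powr_to_infinity[OF assms(1) True] by (subst nn_integral_cmult) auto
      also have "\<dots> = ennreal (q * (g s powr p * (s powr (1 - 1 / p) * s powr (1 / p - 1))))"
        using q by (simp add: mult_ac flip: ennreal_mult)
      also have "s powr (1 - 1 / p) * s powr (1 / p - 1) = 1"
        using True by (simp flip: powr_add)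
      finally show ?thesis using True q by (simp add: ennreal_mult)
    next
      case False
      then show ?thesis by (simp add: k_def)
    qed
  qed
  also have "\<dots> = ennreal q * (\<integral>\<^sup>+s\<in>{0<..}. ennreal (g s powr p) \<partial>lborel)"
    by (intro nn_integral_cmult) measurable
  also have "ennreal (q powr (p - 1)) * (ennreal q * (\<integral>\<^sup>+s\<in>{0<..}. ennreal (g s powr p) \<partial>lborel))
      = ennreal (q powr p) * (\<integral>\<^sup>+s\<in>{0<..}. ennreal (g s powr p) \<partial>lborel)"
    using q by (simp add: powr_diff flip: mult.assoc ennreal_mult)
  finally show ?thesis unfolding q_def .
qed

section \<open>Medians and their distance from the mean\<close>

text \<open>
  The infimum is attained because the distribution function is right continuous, and it is a true infimum:
  the set is nonempty as \<open>c\<close> lies below the total mass, and bounded below as \<open>f\<close> is nonnegative and \<open>c > 0\<close>.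
\<close>

lemma (in finite_measure) quantile_le_iff:
  fixes f :: "'a \<Rightarrow> real"
  assumes [measurable]: "f \<in> borel_measurable M"
    and nonneg: "\<And>x. x \<in> space M \<Longrightarrow> 0 \<le> f x"
    and c: "0 < c" "c < measure M (space M)"
  shows "Inf {a. c \<le> measure M {x \<in> space M. f x \<le> a}} \<le> b \<longleftrightarrow> c \<le> measure M {x \<in> space M. f x \<le> b}"
proof
  let ?F = "\<lambda>a. measure M {x \<in> space M. f x \<le> a}"
  let ?S = "{a. c \<le> ?F a}"
  have mono: "?F a \<le> ?F b" if "a \<le> b" for a b
    using that by (intro finite_measure_mono) auto
  have bdd: "bdd_below ?S"
  proof (rule bdd_belowI)
    fix a assume "a \<in> ?S"
    show "0 \<le> a"
    proof (rule ccontr)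
      assume "\<not> 0 \<le> a"
      then have "{x \<in> space M. f x \<le> a} = {}" using nonneg by force
      then have "?F a = 0" by (simp only: measure_empty)
      with \<open>a \<in> ?S\<close> c show False by simp
    qed
  qed
  show "Inf ?S \<le> b" if "c \<le> ?F b"
    using that bdd by (intro cInf_lower) auto
  assume le: "Inf ?S \<le> b"
  have "(\<lambda>n. ?F (real n)) \<longlonglongrightarrow> measure M (\<Union>n. {x \<in> space M. f x \<le> real n})"
    by (rule finite_Lim_measure_incseq) (auto simp: incseq_def)
  also have "(\<Union>n. {x \<in> space M. f x \<le> real n}) = space M"
    using real_arch_simple by auto
  finally have "eventually (\<lambda>n. c < ?F (real n)) sequentially"
    using c(2) by (rule order_tendstoD)
  then obtain n where "c < ?F (real n)" by (auto simp: eventually_sequentially)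
  then have ne: "?S \<noteq> {}" by (auto intro: less_imp_le)
  have "c \<le> ?F (b + 1 / real (Suc n))" for n
  proof -
    have "Inf ?S < b + 1 / real (Suc n)" using le by (rule le_less_trans) simp
    then obtain a where "a \<in> ?S" "a < b + 1 / real (Suc n)"
      using cInf_less_iff[OF ne bdd] by auto
    then show ?thesis using mono[of a "b + 1 / real (Suc n)"] by simp
  qed
  moreover have "(\<lambda>n. ?F (b + 1 / real (Suc n))) \<longlonglongrightarrow> measure M (\<Inter>n. {x \<in> space M. f x \<le> b + 1 / real (Suc n)})"
  proof (rule finite_Lim_measure_decseq)
    show "decseq (\<lambda>n. {x \<in> space M. f x \<le> b + 1 / real (Suc n)})"
    proof (rule decseq_SucI)
      fix n have "1 / real (Suc (Suc n)) \<le> 1 / real (Suc n)" by (simp add: frac_le)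
      then show "{x \<in> space M. f x \<le> b + 1 / real (Suc (Suc n))} \<subseteq> {x \<in> space M. f x \<le> b + 1 / real (Suc n)}"
        by auto
    qed
  qed auto
  moreover have "(\<Inter>n. {x \<in> space M. f x \<le> b + 1 / real (Suc n)}) = {x \<in> space M. f x \<le> b}"
  proof (intro equalityI subsetI)
    fix x assume x: "x \<in> (\<Inter>n. {x \<in> space M. f x \<le> b + 1 / real (Suc n)})"
    have "f x \<le> b"
    proof (rule ccontr)
      assume "\<not> f x \<le> b"
      then obtain n where "1 / real (Suc n) < f x - b"
        by (metis diff_gt_0_iff_gt nat_approx_posE not_le)
      moreover have "f x \<le> b + 1 / real (Suc n)" using x by blast
      ultimately show False by linarith
    qed
    with x show "x \<in> {x \<in> space M. f x \<le> b}" by auto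
  next
    fix x assume "x \<in> {x \<in> space M. f x \<le> b}"
    then show "x \<in> (\<Inter>n. {x \<in> space M. f x \<le> b + 1 / real (Suc n)})"
      by (auto intro: add_increasing2)
  qed
  ultimately show "c \<le> ?F b" by (metis (no_types, lifting) LIMSEQ_le_const)
qed

text \<open>
  Together with \<open>quantile_le_iff\<close> this says that the lower quantile has mass at most \<open>c\<close> strictly below it:
  \<open>{f < m}\<close> is the increasing union of the sets \<open>{f \<le> a}\<close> with \<open>a < m\<close>.
\<close>

lemma (in finite_measure) measure_less_quantile:
  fixes f :: "'a \<Rightarrow> real"
  assumes [measurable]: "f \<in> borel_measurable M"
    and below: "\<And>a. a < m \<Longrightarrow> measure M {x \<in> space M. f x \<le> a} \<le> c"
  shows "measure M {x \<in> space M. f x < m} \<le> c"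
proof -
  have "(\<lambda>n. measure M {x \<in> space M. f x \<le> m - 1 / real (Suc n)})
      \<longlonglongrightarrow> measure M (\<Union>n. {x \<in> space M. f x \<le> m - 1 / real (Suc n)})"
  proof (rule finite_Lim_measure_incseq)
    show "incseq (\<lambda>n. {x \<in> space M. f x \<le> m - 1 / real (Suc n)})"
    proof (rule incseq_SucI)
      fix n have "1 / real (Suc (Suc n)) \<le> 1 / real (Suc n)" by (simp add: frac_le)
      then show "{x \<in> space M. f x \<le> m - 1 / real (Suc n)} \<subseteq> {x \<in> space M. f x \<le> m - 1 / real (Suc (Suc n))}"
        by auto
    qed
  qed auto
  also have "(\<Union>n. {x \<in> space M. f x \<le> m - 1 / real (Suc n)}) = {x \<in> space M. f x < m}"
  proof (intro equalityI subsetI)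
    fix x assume x: "x \<in> {x \<in> space M. f x < m}"
    then obtain n where "1 / real (Suc n) < m - f x"
      by (metis (no_types, lifting) diff_gt_0_iff_gt mem_Collect_eq nat_approx_posE)
    then have "f x \<le> m - 1 / real (Suc n)" by linarith
    with x show "x \<in> (\<Union>n. {x \<in> space M. f x \<le> m - 1 / real (Suc n)})" by blast
  next
    fix x assume "x \<in> (\<Union>n. {x \<in> space M. f x \<le> m - 1 / real (Suc n)})"
    then obtain n where "x \<in> space M" "f x \<le> m - 1 / real (Suc n)" by auto
    moreover have "0 < 1 / real (Suc n)" by simp
    ultimately show "x \<in> {x \<in> space M. f x < m}" by (smt (verit) mem_Collect_eq)
  qed
  finally show ?thesis by (rule LIMSEQ_le_const2) (auto intro!: below)
qed

text \<open>
  Pointwise, \<open>f - m\<close> is at most \<open>f\<close> where \<open>f > m\<close> and at most \<open>0\<close> elsewhere, and \<open>m - f\<close> is at most \<open>m\<close> where \<open>f < m\<close> and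
  at most \<open>0\<close> elsewhere.
\<close>

lemma (in finite_measure) mean_deviation_bounds:
  fixes f :: "'a \<Rightarrow> real"
  assumes f: "integrable M f" and nonneg: "\<And>x. x \<in> space M \<Longrightarrow> 0 \<le> f x"
    and m: "0 \<le> m" and c: "measure M {x \<in> space M. f x < m} \<le> c"
  shows "integral\<^sup>L M f - measure M (space M) * m \<le> (\<integral>x. f x * indicator {x \<in> space M. m < f x} x \<partial>M)"
    and "measure M (space M) * m - integral\<^sup>L M f \<le> c * m"
proof -
  note [measurable] = borel_measurable_integrable[OF f]
  have *: "(\<integral>x. f x - m \<partial>M) = integral\<^sup>L M f - measure M (space M) * m"
    using f by simp
  have i: "integrable M (\<lambda>x. f x * indicator {x \<in> space M. m < f x} x)"
    by (intro integrable_real_mult_indicator f) auto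
  have "(\<integral>x. f x - m \<partial>M) \<le> (\<integral>x. f x * indicator {x \<in> space M. m < f x} x \<partial>M)"
    using m nonneg f by (intro integral_mono i) (auto split: split_indicator)
  then show "integral\<^sup>L M f - measure M (space M) * m \<le> (\<integral>x. f x * indicator {x \<in> space M. m < f x} x \<partial>M)"
    using * by simp
  have "(\<integral>x. m - f x \<partial>M) \<le> (\<integral>x. m * indicator {x \<in> space M. f x < m} x \<partial>M)"
    using m nonneg f by (intro integral_mono) (auto split: split_indicator simp: emeasure_eq_measure)
  also have "\<dots> = measure M {x \<in> space M. f x < m} * m"
  proof -
    have "{x \<in> space M. f x < m} \<inter> space M = {x \<in> space M. f x < m}" by auto
    then show ?thesis by simp
  qed
  also have "\<dots> \<le> c * m" using c m by (intro mult_right_mono)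
  finally show "measure M (space M) * m - integral\<^sup>L M f \<le> c * m"
    using f by simp
qed

lemma finite_measure_initial_segment: "finite_measure (lebesgue_on {0<..<t::real})"
  by (intro finite_measure_lebesgue_on) (simp add: lmeasurable_box)

lemma initial_segment_measurable:
  "f \<in> borel_measurable half_line \<Longrightarrow> f \<in> borel_measurable (lebesgue_on {0<..<t::real})"
  by (rule measurable_restrict_mono) auto

text \<open>
  This turns statements about the infimum into statements about measures of sublevel sets; in particular it
  gives the measurability of the median as a function of \<open>t\<close>.
\<close>

lemma lower_median_le_iff:
  assumes f: "f \<in> borel_measurable half_line" "\<And>t. 0 < t \<Longrightarrow> 0 \<le> f t" and t: "0 < t"
  shows "lower_median f t \<le> a \<longleftrightarrow> t / 2 \<le> measure lebesgue {s \<in> {0<..<t}. f s \<le> a}"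
proof -
  interpret finite_measure "lebesgue_on {0<..<t}" by (rule finite_measure_initial_segment)
  have eq: "measure lebesgue {s \<in> {0<..<t}. f s \<le> a} = measure (lebesgue_on {0<..<t}) {s \<in> space (lebesgue_on {0<..<t}). f s \<le> a}" for a
    by (subst measure_restrict_space) auto
  show ?thesis unfolding lower_median_def eq
    using f t by (intro quantile_le_iff initial_segment_measurable) (auto simp: measure_restrict_space)
qed

lemma lower_median_nonneg:
  assumes f: "f \<in> borel_measurable half_line" "\<And>t. 0 < t \<Longrightarrow> 0 \<le> f t" and t: "0 < t"
  shows "0 \<le> lower_median f t"
proof (rule ccontr)
  assume "\<not> 0 \<le> lower_median f t"
  then have "{s \<in> {0<..<t}. f s \<le> lower_median f t} = {}" using f(2) by force
  then have "measure lebesgue {s \<in> {0<..<t}. f s \<le> lower_median f t} = 0"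
    by (simp only: measure_empty)
  then show False using lower_median_le_iff[OF f t, of "lower_median f t"] t by simp
qed

lemma average_eq: "average f t = (1 / t) * integral\<^sup>L (lebesgue_on {0<..<t}) f"
  unfolding average_def set_lebesgue_integral_def by (subst integral_restrict_space) auto

text \<open>
  The heart of the matter. The mean exceeds the median by at most the contribution of \<open>{m < f}\<close>, a set of measure
  at most \<open>t / 2\<close>. The median exceeds the mean by at most \<open>m / 2\<close>, and the rearrangement is at least \<open>m\<close>
  on \<open>(0, t / 2)\<close>.
\<close>

lemma median_minus_average_le_rearrangement:
  assumes f: "f \<in> borel_measurable half_line" "\<And>t. 0 < t \<Longrightarrow> 0 \<le> f t"
    and rearr: "rearrangeable half_line f"
    and int: "integrable (lebesgue_on {0<..<t}) f" and t: "0 < t"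
  shows "ennreal (t * \<bar>lower_median f t - average f t\<bar>)
    \<le> (\<integral>\<^sup>+s\<in>{0<..<t / 2}. ennreal (decreasing_rearrangement half_line f s) \<partial>lborel)"
proof -
  interpret rearrangeable half_line f by fact
  define N where "N = lebesgue_on {0<..<t}"
  interpret N: finite_measure N unfolding N_def by (rule finite_measure_initial_segment)
  have space [simp]: "space N = {0<..<t}" by (simp add: N_def)
  have [measurable]: "f \<in> borel_measurable N"
    unfolding N_def using f(1) by (rule initial_segment_measurable)
  have int: "integrable N f" using int by (simp add: N_def)
  define m where "m = lower_median f t"
  have m: "0 \<le> m" unfolding m_def using f t by (rule lower_median_nonneg)
  have N_eq: "measure lebesgue A = measure N A" "emeasure lebesgue A = emeasure N A" if "A \<subseteq> {0<..<t}" for A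
    unfolding N_def using that by (simp_all add: measure_restrict_space emeasure_restrict_space)
  have sub_half_line: "emeasure N A \<le> emeasure half_line B" if "A \<subseteq> {0<..<t}" "A \<subseteq> B" "B \<in> sets half_line" for A B
  proof -
    have "emeasure N A = emeasure half_line A"
      using that N_eq(2)[OF that(1)] by (subst emeasure_restrict_space) auto
    also have "\<dots> \<le> emeasure half_line B" using that by (intro emeasure_mono)
    finally show ?thesis .
  qed
  have total: "measure N {0<..<t} = t" using t by (simp flip: N_eq)
  have le_iff: "m \<le> a \<longleftrightarrow> t / 2 \<le> measure N {s \<in> space N. f s \<le> a}" for a
  proof -
    have "measure lebesgue {s \<in> {0<..<t}. f s \<le> a} = measure N {s \<in> {0<..<t}. f s \<le> a}"
      by (rule N_eq) auto
    then show ?thesis using lower_median_le_iff[OF f t, of a] by (simp add: m_def)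
  qed
  have above: "measure N {s \<in> space N. a < f s} = t - measure N {s \<in> space N. f s \<le> a}" for a
  proof -
    have "measure N (space N - {s \<in> space N. f s \<le> a})
        = measure N (space N) - measure N {s \<in> space N. f s \<le> a}"
      by (rule N.finite_measure_compl) measurable
    moreover have "space N - {s \<in> space N. f s \<le> a} = {s \<in> space N. a < f s}" by auto
    ultimately show ?thesis using total by (simp only: space)
  qed
  have below: "measure N {s \<in> space N. f s < m} \<le> t / 2"
  proof (rule N.measure_less_quantile)
    fix a assume "a < m"
    then have "\<not> t / 2 \<le> measure N {s \<in> space N. f s \<le> a}" using le_iff[of a] by linarith
    then show "measure N {s \<in> space N. f s \<le> a} \<le> t / 2" by linarith
  qed measurable
  have avg: "t * average f t = integral\<^sup>L N f" using t by (simp add: average_eq N_def)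
  note dev = N.mean_deviation_bounds[OF int _ m below]
  let ?R = "\<integral>\<^sup>+s\<in>{0<..<t / 2}. ennreal (rearr s) \<partial>lborel"
  have "ennreal (t * (average f t - m)) \<le> ?R"
  proof -
    define E where "E = {s \<in> space N. m < f s}"
    have E [measurable]: "E \<in> sets N" unfolding E_def by measurable
    have "E = {0<..<t} \<inter> {s \<in> space half_line. m < f s}" by (auto simp: E_def)
    also have "\<dots> \<in> sets half_line"
    proof (rule sets.Int)
      show "{0<..<t} \<in> sets half_line" by (subst sets_restrict_space_iff) auto
      show "{s \<in> space half_line. m < f s} \<in> sets half_line" by measurable
    qed
    finally have E': "E \<in> sets half_line" .
    have "t * (average f t - m) \<le> (\<integral>s. f s * indicator E s \<partial>N)"
      using dev(1) f(2) avg total by (simp add: algebra_simps E_def)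
    then have "ennreal (t * (average f t - m)) \<le> ennreal (\<integral>s. f s * indicator E s \<partial>N)" by (rule ennreal_leI)
    also have "\<dots> = (\<integral>\<^sup>+s. ennreal (f s * indicator E s) \<partial>N)"
      using f(2) int by (intro nn_integral_eq_integral[symmetric] integrable_real_mult_indicator) auto
    also have "\<dots> = (\<integral>\<^sup>+s. ennreal (f s * indicator E s) * indicator {0<..<t} s \<partial>lebesgue)"
      unfolding N_def by (intro nn_integral_restrict_space) auto
    also have "\<dots> = (\<integral>\<^sup>+s. (ennreal (f s) * indicator E s) * indicator {0<..} s \<partial>lebesgue)"
      by (intro nn_integral_cong) (auto simp: E_def split: split_indicator)
    also have "\<dots> = (\<integral>\<^sup>+s\<in>E. ennreal (f s) \<partial>half_line)"
      by (intro nn_integral_restrict_space[symmetric]) auto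
    also have "\<dots> \<le> ?R"
    proof (rule set_nn_integral_le_rearr[OF E'])
      have "emeasure half_line E = emeasure N E"
      proof -
        have sub: "E \<subseteq> {0<..<t}" by (auto simp: E_def)
        then have "emeasure half_line E = emeasure lebesgue E"
          by (intro emeasure_restrict_space) auto
        also have "\<dots> = emeasure N E" by (rule N_eq(2)[OF sub])
        finally show ?thesis .
      qed
      also have "\<dots> \<le> ennreal (t / 2)"
        using above[of m] le_iff[of m] by (simp add: N.emeasure_eq_measure E_def ennreal_leI)
      finally show "emeasure half_line E \<le> ennreal (t / 2)" .
    qed
    finally show ?thesis .
  qed
  moreover have "ennreal (t * (m - average f t)) \<le> ?R"
  proof -
    \<comment> \<open>More than half of \<open>(0, t)\<close> lies above any level below the median.\<close>
    have m_le: "m \<le> rearr s" if s: "0 < s" "s < t / 2" for s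
    proof (rule ccontr)
      assume "\<not> m \<le> rearr s"
      then have "s < measure N {x \<in> space N. rearr s < f x}"
        using le_iff[of "rearr s"] above[of "rearr s"] s by auto
      then have "ennreal s < emeasure N {x \<in> space N. rearr s < f x}"
        using s by (simp add: N.emeasure_eq_measure ennreal_less_iff)
      also have "\<dots> \<le> emeasure half_line {x \<in> space half_line. rearr s < f x}"
        proof (rule sub_half_line)
        show "{x \<in> space half_line. rearr s < f x} \<in> sets half_line" by measurable
      qed auto
      finally have "rearr s < rearr s" using less_rearr_iff[OF s(1) rearr_nonneg[of s]] by (simp only:)
      then show False by simp
    qed
    have "t * (m - average f t) \<le> m * (t / 2)"
      using dev(2) f(2) avg total by (simp add: algebra_simps)
    then have "ennreal (t * (m - average f t)) \<le> ennreal (m * (t / 2))" by (rule ennreal_leI)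
    also have "\<dots> = (\<integral>\<^sup>+s\<in>{0<..<t / 2}. ennreal m \<partial>lborel)"
      using t m by (simp add: nn_integral_cmult_indicator flip: ennreal_mult)
    also have "\<dots> \<le> ?R"
      using m_le by (intro nn_integral_mono) (auto split: split_indicator intro!: ennreal_leI)
    finally show ?thesis .
  qed
  ultimately show ?thesis unfolding m_def by (cases "lower_median f t \<le> average f t") (auto simp: abs_if)
qed

lemma set_nn_integral_rescale:
  fixes F :: "real \<Rightarrow> ennreal"
  assumes [measurable]: "F \<in> borel_measurable borel" and "0 < c" and A [measurable]: "A \<in> sets borel"
  shows "(\<integral>\<^sup>+s\<in>A. F s \<partial>lborel) = ennreal c * (\<integral>\<^sup>+s. F (c * s) * indicator A (c * s) \<partial>lborel)"
  using nn_integral_real_affine[of "\<lambda>s. F s * indicator A s" c 0] \<open>0 < c\<close> by simp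

text \<open>
  For a fixed level \<open>a\<close> the measure of \<open>{s \<in> (0, t). f s \<le> a}\<close> increases with \<open>t\<close>, hence is a Borel function of \<open>t\<close>
  even when \<open>f\<close> is only Lebesgue measurable.
\<close>

lemma lower_median_borel:
  assumes f: "f \<in> borel_measurable half_line" "\<And>t. 0 < t \<Longrightarrow> 0 \<le> f t"
  shows "(\<lambda>t. if 0 < t then lower_median f t else 0) \<in> borel_measurable borel"
proof (rule borel_measurableI_le)
  fix a :: real
  define G where "G t = measure lebesgue {s \<in> {0<..<t}. f s \<le> a}" for t
  have "mono G"
  proof (rule monoI)
    fix x y :: real assume "x \<le> y"
    have m: "{s \<in> {0<..<t}. f s \<le> a} \<in> lmeasurable" for t
    proof (rule fmeasurableI2[of "{0<..<t}"])
      have "{s \<in> space (lebesgue_on {0<..<t}). f s \<le> a} \<in> sets (lebesgue_on {0<..<t})"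
        using initial_segment_measurable[OF f(1)] by measurable
      then show "{s \<in> {0<..<t}. f s \<le> a} \<in> sets lebesgue" by (simp add: sets_restrict_space_iff)
    qed (auto simp: lmeasurable_box)
    show "G x \<le> G y" unfolding G_def using \<open>x \<le> y\<close>
      by (intro measure_mono_fmeasurable fmeasurableD m) auto
  qed
  then have [measurable]: "G \<in> borel_measurable borel" by (rule borel_measurable_mono)
  have "{t \<in> space borel. (if 0 < t then lower_median f t else 0) \<le> a}
      = {t \<in> space borel. 0 < t \<and> t / 2 \<le> G t} \<union> {t \<in> space borel. \<not> 0 < t \<and> 0 \<le> a}"
    using lower_median_le_iff[OF f] by (auto simp: G_def)
  also have "\<dots> \<in> sets borel" by measurable
  finally show "{t \<in> space borel. (if 0 < t then lower_median f t else 0) \<le> a} \<in> sets borel" .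
qed

text \<open>
  The integral of a nonnegative function over \<open>(0, t)\<close> increases with \<open>t\<close>.
\<close>

lemma average_borel:
  assumes nonneg: "\<And>t. 0 < t \<Longrightarrow> 0 \<le> f t"
    and int: "\<And>t. 0 < t \<Longrightarrow> integrable (lebesgue_on {0<..<t}) f"
  shows "average f \<in> borel_measurable borel"
proof -
  define G where "G t = (LINT s:{0<..<t}|lebesgue. f s)" for t
  have set_int: "set_integrable lebesgue {0<..<t} f" if "0 < t" for t
    using int[OF that] by (simp add: set_integrable_def integrable_restrict_space)
  have "mono G"
  proof (rule monoI)
    fix x y :: real assume "x \<le> y"
    show "G x \<le> G y"
    proof (cases "0 < x")
      case True
      then show ?thesis
        using \<open>x \<le> y\<close> set_int[of x] set_int[of y] nonneg
        unfolding G_def set_lebesgue_integral_def set_integrable_def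
        by (intro integral_mono) (auto split: split_indicator)
    next
      case False
      then have "G x = 0" by (simp add: G_def set_lebesgue_integral_def)
      also have "0 \<le> G y" unfolding G_def set_lebesgue_integral_def
        using nonneg by (intro integral_nonneg_AE) (auto split: split_indicator)
      finally show ?thesis .
    qed
  qed
  then have [measurable]: "G \<in> borel_measurable borel" by (rule borel_measurable_mono)
  have "average f = (\<lambda>t. (1 / t) * G t)" by (simp add: fun_eq_iff average_def G_def)
  then show ?thesis by simp
qed

section \<open>The norm inequality\<close>

text \<open>
  Chebyshev's inequality: the measure of \<open>{l < f}\<close> is at most the integral of \<open>\<bar>f\<bar> powr p\<close> divided by \<open>l powr p\<close>.
\<close>

lemma rearrangeable_of_Lp:
  assumes "0 < p" and f: "f \<in> Lp p" and nonneg: "\<And>t. 0 < t \<Longrightarrow> 0 \<le> f t"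
  shows "rearrangeable half_line f"
proof -
  have meas [measurable]: "f \<in> borel_measurable half_line"
    and int: "integrable half_line (\<lambda>t. \<bar>f t\<bar> powr p)" using f by (auto simp: Lp_def)
  have sf: "sigma_finite_measure half_line"
    by (intro sigma_finite_measure_restrict_space sigma_finite_lebesgue) auto
  have "\<exists>l\<ge>0. emeasure half_line {x \<in> space half_line. l < f x} \<le> ennreal s" if s: "0 < s" for s
  proof -
    define I where "I = (LINT t|half_line. \<bar>f t\<bar> powr p)"
    have I: "0 \<le> I" by (simp add: I_def)
    \<comment> \<open>Adding \<open>1\<close> keeps the level positive when \<open>f\<close> vanishes almost everywhere.\<close>
    define c where "c = (I + 1) / s"
    have c: "0 < c" using I s by (simp add: c_def)
    define l where "l = c powr (1 / p)"
    let ?A = "{x \<in> space half_line. l < f x}"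
    have lp: "l powr p = c" using c \<open>0 < p\<close> by (simp add: l_def powr_powr)
    have "ennreal c * emeasure half_line ?A = (\<integral>\<^sup>+x. ennreal c * indicator ?A x \<partial>half_line)"
      by (intro nn_integral_cmult_indicator[symmetric]) measurable
    also have "\<dots> \<le> (\<integral>\<^sup>+x. ennreal (\<bar>f x\<bar> powr p) \<partial>half_line)"
    proof (rule nn_integral_mono)
      fix x assume "x \<in> space half_line"
      have "c \<le> \<bar>f x\<bar> powr p" if "l < f x"
        unfolding lp[symmetric] using that \<open>0 < p\<close> by (intro powr_mono2) (auto simp: l_def)
      then show "ennreal c * indicator ?A x \<le> ennreal (\<bar>f x\<bar> powr p)"
        by (auto split: split_indicator intro: ennreal_leI)
    qed
    also have "\<dots> = ennreal I"
      unfolding I_def by (intro nn_integral_eq_integral int) auto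
    finally have le: "ennreal c * emeasure half_line ?A \<le> ennreal I" .
    have "emeasure half_line ?A \<le> ennreal s"
    proof (cases "emeasure half_line ?A")
      case (real r)
      then have "c * r \<le> I" using le c I by (simp flip: ennreal_mult)
      also have "I \<le> c * s" using s by (simp add: c_def)
      finally show ?thesis using real c by (simp add: ennreal_leI)
    next
      case top
      then show ?thesis using le c by (simp add: ennreal_mult_top top_unique)
    qed
    then show ?thesis by (intro exI[of _ l]) (simp add: l_def)
  qed
  then show ?thesis
    using sf meas nonneg by (simp add: rearrangeable_def rearrangeable_axioms_def)
qed

lemma locally_integrable_of_Lp:
  assumes "1 < p" and f: "f \<in> Lp p"
  shows "integrable (lebesgue_on {0<..<t}) f"
proof -
  have meas: "f \<in> borel_measurable half_line"
    and int: "integrable half_line (\<lambda>t. \<bar>f t\<bar> powr p)" using f by (auto simp: Lp_def)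
  interpret finite_measure "lebesgue_on {0<..<t}" by (rule finite_measure_initial_segment)
  have "set_integrable lebesgue {0<..} (\<lambda>t. \<bar>f t\<bar> powr p)"
    using int by (simp add: set_integrable_def integrable_restrict_space)
  then have "set_integrable lebesgue {0<..<t} (\<lambda>t. \<bar>f t\<bar> powr p)"
    by (rule set_integrable_subset) auto
  then have "integrable (lebesgue_on {0<..<t}) (\<lambda>t. \<bar>f t\<bar> powr p)"
    by (simp add: set_integrable_def integrable_restrict_space)
  then have "integrable (lebesgue_on {0<..<t}) (\<lambda>t. 1 + \<bar>f t\<bar> powr p)" by simp
  then show ?thesis
  proof (rule Bochner_Integration.integrable_bound)
    show "f \<in> borel_measurable (lebesgue_on {0<..<t})" using meas by (rule initial_segment_measurable)
    \<comment> \<open>On a set of finite measure \<open>1 + \<bar>f\<bar> powr p\<close> is an integrable majorant.\<close>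
    have "x \<le> 1 + x powr p" if "0 \<le> x" for x :: real
    proof (cases "x \<le> 1")
      case True
      have "0 \<le> x powr p" by simp
      with True show ?thesis by linarith
    next
      case False
      then have "x powr 1 \<le> x powr p" using assms by (intro powr_mono) auto
      with False show ?thesis by simp
    qed
    then show "AE x in lebesgue_on {0<..<t}. norm (f x) \<le> norm (1 + \<bar>f x\<bar> powr p)"
      by (intro AE_I2) (metis abs_ge_zero abs_ge_self order_trans real_norm_def)
  qed
qed

lemma nn_integral_half_line:
  "(\<integral>\<^sup>+t. F t \<partial>half_line) = (\<integral>\<^sup>+t\<in>{0<..}. F t \<partial>lborel)"
  by (simp add: nn_integral_restrict_space nn_integral_completion)

lemma half_line_measurable_cong:
  assumes "g \<in> borel_measurable borel" and "\<And>t. 0 < t \<Longrightarrow> g t = h t"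
  shows "h \<in> borel_measurable half_line"
proof -
  have "g \<in> borel_measurable half_line"
    using assms(1) by (intro measurable_restrict_space1 measurable_completion) simp
  then show ?thesis using assms(2) by (subst measurable_cong[of _ _ g]) auto
qed

theorem theorem1:
  fixes p :: real and f :: "real \<Rightarrow> real"
  assumes "p > 1"
    and "f \<in> borel_measurable half_line"
    and "\<And>t. t > 0 \<Longrightarrow> f t \<ge> 0"
    and "f \<in> Lp p"
  shows "(\<lambda>t. lower_median f t - average f t) \<in> Lp p \<and>
         (LINT t|half_line. \<bar>lower_median f t - average f t\<bar> powr p)
           \<le> 2 powr (1 - p) * (p / (p - 1)) powr p * (LINT t|half_line. f t powr p) \<and>
         Lp_norm p (\<lambda>t. lower_median f t - average f t)
           \<le> 2 powr (1 / p - 1) * (p / (p - 1)) * Lp_norm p f"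
proof -
  note f = assms(2) and nonneg = assms(3)
  define d where "d t = lower_median f t - average f t" for t
  define I where "I = (LINT t|half_line. f t powr p)"
  define K where "K = (p / (p - 1)) powr p"
  have rearr: "rearrangeable half_line f"
    using assms by (intro rearrangeable_of_Lp[of p]) auto
  interpret rearrangeable half_line f by fact
  have loc_int: "integrable (lebesgue_on {0<..<t}) f" for t
    using assms by (intro locally_integrable_of_Lp)
  have I_abs: "(LINT t|half_line. \<bar>f t\<bar> powr p) = I"
    unfolding I_def using nonneg by (intro Bochner_Integration.integral_cong) auto
  have nn_I: "(\<integral>\<^sup>+t. ennreal (f t powr p) \<partial>half_line) = ennreal I"
  proof -
    have "(\<integral>\<^sup>+t. ennreal (f t powr p) \<partial>half_line) = (\<integral>\<^sup>+t. ennreal (\<bar>f t\<bar> powr p) \<partial>half_line)"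
      using nonneg by (intro nn_integral_cong) auto
    also have "\<dots> = ennreal I"
      unfolding I_abs[symmetric] using \<open>f \<in> Lp p\<close>
      by (intro nn_integral_eq_integral) (auto simp: Lp_def)
    finally show ?thesis .
  qed
  have I: "0 \<le> I" by (simp add: I_def)
  \<comment> \<open>The average of \<open>g\<close> over \<open>(0, t)\<close> is half the average of the rearrangement over \<open>(0, t / 2)\<close>.\<close>
  define g where "g s = rearr (1 / 2 * s) / 2" for s
  have g [measurable]: "g \<in> borel_measurable borel" unfolding g_def by measurable
  have g_nonneg: "0 \<le> g s" for s by (simp add: g_def rearr_nonneg)
  have hardy: "(\<integral>\<^sup>+t\<in>{0<..}. ennreal (\<bar>d t\<bar> powr p) \<partial>lborel)
      \<le> ennreal K * (\<integral>\<^sup>+s\<in>{0<..}. ennreal (g s powr p) \<partial>lborel)"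
    unfolding K_def
  proof (rule hardy_inequality[OF assms(1) g g_nonneg])
    fix t :: real assume t: "0 < t"
    have "ennreal (t * \<bar>d t\<bar>) \<le> (\<integral>\<^sup>+s\<in>{0<..<t / 2}. ennreal (rearr s) \<partial>lborel)"
      unfolding d_def by (intro median_minus_average_le_rearrangement f nonneg rearr loc_int t)
    also have "\<dots> = ennreal (1 / 2) * (\<integral>\<^sup>+s. ennreal (rearr (1 / 2 * s)) * indicator {0<..<t / 2} (1 / 2 * s) \<partial>lborel)"
      by (rule set_nn_integral_rescale) auto
    also have "\<dots> = (\<integral>\<^sup>+s. ennreal (1 / 2) * (ennreal (rearr (1 / 2 * s)) * indicator {0<..<t / 2} (1 / 2 * s)) \<partial>lborel)"
      by (intro nn_integral_cmult[symmetric]) measurable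
    also have "\<dots> = (\<integral>\<^sup>+s\<in>{0<..<t}. ennreal (g s) \<partial>lborel)"
    proof (rule nn_integral_cong)
      fix s
      have "ennreal (1 / 2) * ennreal (rearr (1 / 2 * s)) = ennreal (g s)"
        by (subst ennreal_mult[symmetric]) (simp_all add: g_def rearr_nonneg)
      moreover have "indicator {0<..<t / 2} (1 / 2 * s) = (indicator {0<..<t} s :: ennreal)"
        by (auto split: split_indicator)
      ultimately show "ennreal (1 / 2) * (ennreal (rearr (1 / 2 * s)) * indicator {0<..<t / 2} (1 / 2 * s))
          = ennreal (g s) * indicator {0<..<t} s"
        by (simp only: mult.assoc[symmetric])
    qed
    finally show "ennreal (t * \<bar>d t\<bar>) \<le> (\<integral>\<^sup>+s\<in>{0<..<t}. ennreal (g s) \<partial>lborel)" .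
  qed simp
  have g_norm: "(\<integral>\<^sup>+s\<in>{0<..}. ennreal (g s powr p) \<partial>lborel) = ennreal (2 powr (1 - p) * I)"
  proof -
    have "ennreal I = (\<integral>\<^sup>+s\<in>{0<..}. ennreal (rearr s powr p) \<partial>lborel)"
      using nn_integral_rearr_powr[of p] nn_I assms(1) by simp
    also have "\<dots> = ennreal (1 / 2) * (\<integral>\<^sup>+s. ennreal (rearr (1 / 2 * s) powr p) * indicator {0<..} (1 / 2 * s) \<partial>lborel)"
      by (rule set_nn_integral_rescale) auto
    finally have "ennreal (2 powr (1 - p)) * ennreal I = ennreal (2 powr (1 - p)) * (ennreal (1 / 2)
        * (\<integral>\<^sup>+s. ennreal (rearr (1 / 2 * s) powr p) * indicator {0<..} (1 / 2 * s) \<partial>lborel))" by simp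
    also have "\<dots> = ennreal (2 powr - p)
        * (\<integral>\<^sup>+s. ennreal (rearr (1 / 2 * s) powr p) * indicator {0<..} (1 / 2 * s) \<partial>lborel)"
    proof -
      have "ennreal (2 powr (1 - p)) * ennreal (1 / 2) = ennreal (2 powr (1 - p) * (1 / 2))"
        by (rule ennreal_mult[symmetric]) simp_all
      also have "2 powr (1 - p) * (1 / 2) = 2 powr - p"
        by (simp add: powr_diff powr_minus_divide)
      finally show ?thesis by (simp only: mult.assoc[symmetric])
    qed
    also have "\<dots> = (\<integral>\<^sup>+s. ennreal (2 powr - p)
        * (ennreal (rearr (1 / 2 * s) powr p) * indicator {0<..} (1 / 2 * s)) \<partial>lborel)"
      by (intro nn_integral_cmult[symmetric]) measurable
    also have "\<dots> = (\<integral>\<^sup>+s\<in>{0<..}. ennreal (g s powr p) \<partial>lborel)"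
    proof (rule nn_integral_cong)
      fix s
      have "2 powr - p * rearr (1 / 2 * s) powr p = g s powr p"
        by (simp add: g_def rearr_nonneg powr_divide powr_minus_divide)
      then have "ennreal (2 powr - p) * ennreal (rearr (1 / 2 * s) powr p) = ennreal (g s powr p)"
        by (subst ennreal_mult[symmetric]) simp_all
      moreover have "indicator {0<..} (1 / 2 * s) = (indicator {0<..} s :: ennreal)"
        by (auto split: split_indicator)
      ultimately show "ennreal (2 powr - p) * (ennreal (rearr (1 / 2 * s) powr p) * indicator {0<..} (1 / 2 * s))
          = ennreal (g s powr p) * indicator {0<..} s"
        by (simp only: mult.assoc[symmetric])
    qed
    finally show ?thesis using I by (simp add: ennreal_mult)
  qed
  have nn_d: "(\<integral>\<^sup>+t. ennreal (\<bar>d t\<bar> powr p) \<partial>half_line) \<le> ennreal (2 powr (1 - p) * K * I)"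
    using hardy I unfolding nn_integral_half_line g_norm
    by (simp add: K_def mult_ac flip: ennreal_mult)
  have d_meas: "d \<in> borel_measurable half_line"
  proof (rule half_line_measurable_cong)
    have [measurable]: "(\<lambda>t. if 0 < t then lower_median f t else 0) \<in> borel_measurable borel"
        "average f \<in> borel_measurable borel"
      using f nonneg loc_int by (auto intro!: lower_median_borel average_borel)
    show "(\<lambda>t. (if 0 < t then lower_median f t else 0) - average f t) \<in> borel_measurable borel"
      by measurable
  qed (simp add: d_def)
  have d_int: "integrable half_line (\<lambda>t. \<bar>d t\<bar> powr p)"
  proof (rule integrableI_bounded)
    show "(\<lambda>t. \<bar>d t\<bar> powr p) \<in> borel_measurable half_line" using d_meas by measurable
    show "(\<integral>\<^sup>+t. ennreal (norm (\<bar>d t\<bar> powr p)) \<partial>half_line) < \<infinity>"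
      using nn_d by (simp add: order_le_less_trans)
  qed
  have bound: "(LINT t|half_line. \<bar>d t\<bar> powr p) \<le> 2 powr (1 - p) * K * I"
  proof -
    have "ennreal (LINT t|half_line. \<bar>d t\<bar> powr p) \<le> ennreal (2 powr (1 - p) * K * I)"
      using nn_d nn_integral_eq_integral[OF d_int] by simp
    then show ?thesis using I by (simp add: K_def)
  qed
  have "Lp_norm p d \<le> 2 powr (1 / p - 1) * (p / (p - 1)) * Lp_norm p f"
  proof -
    have "Lp_norm p d \<le> (2 powr (1 - p) * K * I) powr (1 / p)"
      unfolding Lp_norm_def using bound assms(1) by (intro powr_mono2) auto
    also have "\<dots> = (2 powr (1 - p)) powr (1 / p) * K powr (1 / p) * I powr (1 / p)"
      using I by (simp add: powr_mult K_def)
    also have "K powr (1 / p) = p / (p - 1)"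
      using assms(1) by (simp add: K_def powr_powr)
    also have "(2 powr (1 - p)) powr (1 / p) = 2 powr (1 / p - 1)"
      using assms(1) by (simp add: powr_powr diff_divide_distrib)
    finally show ?thesis by (simp add: Lp_norm_def I_abs)
  qed
  with d_meas d_int bound show ?thesis
    unfolding d_def[abs_def] I_def K_def Lp_def by simp
qed

end
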